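(* Let $k$ be an algebraically closed field of characteristic zero. Let $A$ be a finite-dimensional basic $k$-algebra with Gabriel quiver $Q_A$. Let $B$ be a basic $k$-algebra with Gabriel quiver $Q_B$ which is a subalgebra of $A$, such that the set of arrows of $Q_B$ is a subset of the set of arrows of $Q_A$ and such that $A$ and $B$ have the same semisimple part. Let $Q_C$ be the quiver with the same vertices as $Q_A$ whose arrows are the arrows of $Q_A$ that are not arrows of $Q_B$. If $Q_C$ has no parallel arrows and at most one loop at each vertex, then $\mathrm{HH}^1(A|B)$ is a solvable Lie algebra.
   Context: Relative first Hochschild cohomology: for a $k$-algebra $A$ and a subalgebra $B\subseteq A$, let $\mathrm{Der}_{B^e}(A)$ be the Lie algebra (under the commutator bracket) of $k$-linear derivations $A\to A$ which are $B$-bimodule homomorphisms (equivalently, which vanish on $B$), and let $\mathrm{Inn}_{B^e}(A)$ be the Lie ideal of those inner derivations of $A$ which are $B$-bimodule homomorphisms. Then $\mathrm{HH}^1(A|B)=\mathrm{Der}_{B^e}(A)/\mathrm{Inn}_{B^e}(A)$, with the induced Lie bracket. Convention on quivers: the arrows of $Q_B$ being a subset of those of $Q_A$ is understood compatibly with the inclusion $B\subseteq A$: $Q_A$ and $Q_B$ have the same vertices (the same complete set of primitive orthogonal idempotents), and there are surjections $\nu_A:kQ_A\to A$, $\nu_B:kQ_B\to B$ with admissible kernels such that $\nu_A$ restricted to $kQ_B\subseteq kQ_A$ equals $\nu_B$ followed by the inclusion $B\subseteq A$. Two distinct arrows are parallel if they have the same source and the same target. *)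

theory Defs
  imports
    Complex_Main
    "HOL-Computational_Algebra.Polynomial"
    "HOL-Library.Poly_Mapping"
    "HOL-Library.FuncSet"
    "Graph_Theory.Arc_Walk"
    "Graph_Theory.Digraph_Component"
begin

section \<open>Algebras and subalgebras\<close>

locale assoc_algebra = vector_space scale
  for scale :: "'k::field \<Rightarrow> 'a::ring_1 \<Rightarrow> 'a" +
  assumes scale_mult_left: "scale c x * y = scale c (x * y)"
    and mult_scale_right: "x * scale c y = scale c (x * y)"

definition finite_dimensional :: "('k::field \<Rightarrow> 'a::ring_1 \<Rightarrow> 'a) \<Rightarrow> bool" where
  "finite_dimensional scale \<longleftrightarrow> (\<exists>X. finite X \<and> module.span scale X = UNIV)"

definition subalgebra :: "('k::field \<Rightarrow> 'a::ring_1 \<Rightarrow> 'a) \<Rightarrow> 'a set \<Rightarrow> bool" where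
  "subalgebra scale S \<longleftrightarrow>
     module.subspace scale S \<and> 1 \<in> S \<and> (\<forall>x\<in>S. \<forall>y\<in>S. x * y \<in> S)"

text \<open>
  Ring-theoretic notions below are relative to a unital subalgebra \<open>S\<close> of the ambient
  algebra, so that they apply both to the ambient algebra (\<open>S = UNIV\<close>) and to a subalgebra.
\<close>

definition left_ideal :: "'a::ring_1 set \<Rightarrow> 'a set \<Rightarrow> bool" where
  "left_ideal S M \<longleftrightarrow> M \<subseteq> S \<and> 0 \<in> M \<and> (\<forall>x\<in>M. \<forall>y\<in>M. x - y \<in> M) \<and> (\<forall>s\<in>S. \<forall>x\<in>M. s * x \<in> M)"

definition maximal_left_ideal :: "'a::ring_1 set \<Rightarrow> 'a set \<Rightarrow> bool" where
  "maximal_left_ideal S M \<longleftrightarrow>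
     left_ideal S M \<and> M \<noteq> S \<and> (\<forall>N. left_ideal S N \<and> M \<subseteq> N \<longrightarrow> N = M \<or> N = S)"

definition jacobson_radical :: "'a::ring_1 set \<Rightarrow> 'a set" where
  "jacobson_radical S = S \<inter> \<Inter>{M. maximal_left_ideal S M}"

definition jacobson_radical_sq :: "('k::field \<Rightarrow> 'a::ring_1 \<Rightarrow> 'a) \<Rightarrow> 'a set \<Rightarrow> 'a set" where
  "jacobson_radical_sq scale S =
     module.span scale {x * y | x y. x \<in> jacobson_radical S \<and> y \<in> jacobson_radical S}"

section \<open>Basic algebras and their Gabriel quivers\<close>

definition primitive_idempotent :: "'a::ring_1 set \<Rightarrow> 'a \<Rightarrow> bool" where
  "primitive_idempotent S e \<longleftrightarrow> e \<in> S \<and> e * e = e \<and> e \<noteq> 0 \<and>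
     \<not> (\<exists>f\<in>S. \<exists>g\<in>S. f * f = f \<and> g * g = g \<and> f * g = 0 \<and> g * f = 0 \<and>
          f \<noteq> 0 \<and> g \<noteq> 0 \<and> e = f + g)"

definition complete_primitive_orthogonal_idempotents ::
    "'a::ring_1 set \<Rightarrow> 'v set \<Rightarrow> ('v \<Rightarrow> 'a) \<Rightarrow> bool" where
  "complete_primitive_orthogonal_idempotents S V e \<longleftrightarrow>
     finite V \<and> (\<forall>v\<in>V. primitive_idempotent S (e v)) \<and>
     (\<forall>v\<in>V. \<forall>w\<in>V. v \<noteq> w \<longrightarrow> e v * e w = 0) \<and> (\<Sum>v\<in>V. e v) = 1"

definition right_modules_isomorphic :: "'a::ring_1 set \<Rightarrow> 'a set \<Rightarrow> 'a set \<Rightarrow> bool" where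
  "right_modules_isomorphic S M N \<longleftrightarrow>
     (\<exists>f. bij_betw f M N \<and> (\<forall>x\<in>M. \<forall>y\<in>M. f (x + y) = f x + f y) \<and>
          (\<forall>x\<in>M. \<forall>s\<in>S. f (x * s) = f x * s))"

definition basic_algebra :: "'a::ring_1 set \<Rightarrow> bool" where
  "basic_algebra S \<longleftrightarrow>
     (\<exists>E. complete_primitive_orthogonal_idempotents S E (\<lambda>x. x) \<and>
          (\<forall>e\<in>E. \<forall>f\<in>E. e \<noteq> f \<longrightarrow>
             \<not> right_modules_isomorphic S {e * s | s. s \<in> S} {f * s | s. s \<in> S}))"

text \<open>
  Quivers are finite multidigraphs. The arrows from \<open>i\<close> to \<open>j\<close> correspond to the elements
  of a basis of \<open>e\<^sub>i (rad S / rad\<^sup>2 S) e\<^sub>j\<close>; the family \<open>b\<close> consists of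
  representatives in \<open>e\<^sub>i (rad S) e\<^sub>j\<close> of such a basis.
\<close>

definition arrows_between :: "('v, 'e) pre_digraph \<Rightarrow> 'v \<Rightarrow> 'v \<Rightarrow> 'e set" where
  "arrows_between Q i j = {a \<in> arcs Q. tail Q a = i \<and> head Q a = j}"

definition gabriel_quiver ::
    "('k::field \<Rightarrow> 'a::ring_1 \<Rightarrow> 'a) \<Rightarrow> 'a set \<Rightarrow> ('v, 'e) pre_digraph \<Rightarrow> ('v \<Rightarrow> 'a) \<Rightarrow> bool" where
  "gabriel_quiver scale S Q e \<longleftrightarrow>
     fin_digraph Q \<and> complete_primitive_orthogonal_idempotents S (verts Q) e \<and>
     (\<exists>b :: 'e \<Rightarrow> 'a. \<forall>i\<in>verts Q. \<forall>j\<in>verts Q.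
        (\<forall>a\<in>arrows_between Q i j. b a \<in> {e i * x * e j | x. x \<in> jacobson_radical S}) \<and>
        (\<forall>x\<in>{e i * x * e j | x. x \<in> jacobson_radical S}.
           \<exists>!c. c \<in> arrows_between Q i j \<rightarrow>\<^sub>E (UNIV :: 'k set) \<and>
                x - (\<Sum>a\<in>arrows_between Q i j. scale (c a) (b a)) \<in> jacobson_radical_sq scale S))"

text \<open>
  A semisimple part is a complement of the radical that is a subalgebra (as in the
  Wedderburn--Malcev theorem).
\<close>

definition semisimple_part ::
    "('k::field \<Rightarrow> 'a::ring_1 \<Rightarrow> 'a) \<Rightarrow> 'a set \<Rightarrow> 'a set \<Rightarrow> bool" where
  "semisimple_part scale S E \<longleftrightarrow>
     subalgebra scale E \<and> E \<subseteq> S \<and> E \<inter> jacobson_radical S = {0} \<and>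
     {x + y | x y. x \<in> E \<and> y \<in> jacobson_radical S} = S"

section \<open>Path algebras and presentations\<close>

text \<open>
  A path is a pair of its source and its list of arrows, in order of traversal; the
  stationary path at \<open>v\<close> is \<open>(v, [])\<close>. Composition reads from left to right, so paths
  from \<open>i\<close> to \<open>j\<close> span \<open>e\<^sub>i kQ e\<^sub>j\<close>. Elements of the path algebra are finitely
  supported functions on paths; for a subquiver with the same vertices, source and target
  maps, the path algebra is literally a subset.
\<close>

definition quiver_paths :: "('v, 'e) pre_digraph \<Rightarrow> ('v \<times> 'e list) set" where
  "quiver_paths Q = {(u, p). \<exists>w. pre_digraph.awalk Q u p w}"

definition path_algebra :: "('v, 'e) pre_digraph \<Rightarrow> ('v \<times> 'e list \<Rightarrow>\<^sub>0 'k::field) set" where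
  "path_algebra Q = {f. Poly_Mapping.keys f \<subseteq> quiver_paths Q}"

definition path_mult :: "('v, 'e) pre_digraph \<Rightarrow> ('v \<times> 'e list \<Rightarrow>\<^sub>0 'k::field) \<Rightarrow>
    ('v \<times> 'e list \<Rightarrow>\<^sub>0 'k) \<Rightarrow> ('v \<times> 'e list \<Rightarrow>\<^sub>0 'k)" where
  "path_mult Q f g =
     (\<Sum>p\<in>Poly_Mapping.keys f. \<Sum>q\<in>Poly_Mapping.keys g.
        if pre_digraph.awlast Q (fst p) (snd p) = fst q
        then Poly_Mapping.single (fst p, snd p @ snd q)
               (Poly_Mapping.lookup f p * Poly_Mapping.lookup g q)
        else 0)"

definition path_one :: "('v, 'e) pre_digraph \<Rightarrow> ('v \<times> 'e list \<Rightarrow>\<^sub>0 'k::field)" where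
  "path_one Q = (\<Sum>v\<in>verts Q. Poly_Mapping.single (v, []) 1)"

definition path_scale :: "'k::field \<Rightarrow> ('v \<times> 'e list \<Rightarrow>\<^sub>0 'k) \<Rightarrow> ('v \<times> 'e list \<Rightarrow>\<^sub>0 'k)" where
  "path_scale c f = Poly_Mapping.map (\<lambda>x. c * x) f"

definition path_algebra_hom :: "('k::field \<Rightarrow> 'a::ring_1 \<Rightarrow> 'a) \<Rightarrow> ('v, 'e) pre_digraph \<Rightarrow>
    (('v \<times> 'e list \<Rightarrow>\<^sub>0 'k) \<Rightarrow> 'a) \<Rightarrow> bool" where
  "path_algebra_hom scale Q \<nu> \<longleftrightarrow>
     (\<forall>f\<in>path_algebra Q. \<forall>g\<in>path_algebra Q. \<nu> (f + g) = \<nu> f + \<nu> g) \<and>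
     (\<forall>c. \<forall>f\<in>path_algebra Q. \<nu> (path_scale c f) = scale c (\<nu> f)) \<and>
     (\<forall>f\<in>path_algebra Q. \<forall>g\<in>path_algebra Q. \<nu> (path_mult Q f g) = \<nu> f * \<nu> g) \<and>
     \<nu> (path_one Q) = 1"

text \<open>The \<open>m\<close>-th power of the ideal generated by the arrows is spanned by the paths of
  length at least \<open>m\<close>.\<close>

definition arrow_ideal_power :: "('v, 'e) pre_digraph \<Rightarrow> nat \<Rightarrow> ('v \<times> 'e list \<Rightarrow>\<^sub>0 'k::field) set" where
  "arrow_ideal_power Q m =
     {f \<in> path_algebra Q. \<forall>p\<in>Poly_Mapping.keys f. m \<le> length (snd p)}"

definition admissible :: "('v, 'e) pre_digraph \<Rightarrow> ('v \<times> 'e list \<Rightarrow>\<^sub>0 'k::field) set \<Rightarrow> bool" where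
  "admissible Q I \<longleftrightarrow>
     (\<exists>m\<ge>2. arrow_ideal_power Q m \<subseteq> I \<and> I \<subseteq> arrow_ideal_power Q 2)"

text \<open>The ideal property of the kernel need not be required in \<^const>\<open>admissible\<close>, as it
  is automatic for the kernel of a homomorphism.\<close>

definition admissible_presentation :: "('k::field \<Rightarrow> 'a::ring_1 \<Rightarrow> 'a) \<Rightarrow> 'a set \<Rightarrow>
    ('v, 'e) pre_digraph \<Rightarrow> ('v \<Rightarrow> 'a) \<Rightarrow> (('v \<times> 'e list \<Rightarrow>\<^sub>0 'k) \<Rightarrow> 'a) \<Rightarrow> bool" where
  "admissible_presentation scale S Q e \<nu> \<longleftrightarrow>
     path_algebra_hom scale Q \<nu> \<and> \<nu> ` path_algebra Q = S \<and>
     admissible Q {f \<in> path_algebra Q. \<nu> f = 0} \<and>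
     (\<forall>v\<in>verts Q. \<nu> (Poly_Mapping.single (v, []) 1) = e v)"

definition parallel_arrows :: "('v, 'e) pre_digraph \<Rightarrow> 'e \<Rightarrow> 'e \<Rightarrow> bool" where
  "parallel_arrows Q a b \<longleftrightarrow> a \<noteq> b \<and> tail Q a = tail Q b \<and> head Q a = head Q b"

definition complement_quiver ::
    "('v, 'e) pre_digraph \<Rightarrow> ('v, 'e) pre_digraph \<Rightarrow> ('v, 'e) pre_digraph" where
  "complement_quiver QA QB =
     \<lparr>verts = verts QA, arcs = arcs QA - arcs QB, tail = tail QA, head = head QA\<rparr>"

section \<open>Lie algebras\<close>

record ('k, 'l) lie_structure =
  lcarrier :: "'l set"
  lzero :: 'l
  ladd :: "'l \<Rightarrow> 'l \<Rightarrow> 'l"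
  lscale :: "'k \<Rightarrow> 'l \<Rightarrow> 'l"
  lbracket :: "'l \<Rightarrow> 'l \<Rightarrow> 'l"

locale lie_algebra =
  fixes L :: "('k::field, 'l) lie_structure"
  assumes zero_closed: "lzero L \<in> lcarrier L"
    and add_closed: "\<lbrakk>x \<in> lcarrier L; y \<in> lcarrier L\<rbrakk> \<Longrightarrow> ladd L x y \<in> lcarrier L"
    and scale_closed: "x \<in> lcarrier L \<Longrightarrow> lscale L c x \<in> lcarrier L"
    and bracket_closed: "\<lbrakk>x \<in> lcarrier L; y \<in> lcarrier L\<rbrakk> \<Longrightarrow> lbracket L x y \<in> lcarrier L"
    and add_assoc: "\<lbrakk>x \<in> lcarrier L; y \<in> lcarrier L; z \<in> lcarrier L\<rbrakk> \<Longrightarrow>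
      ladd L (ladd L x y) z = ladd L x (ladd L y z)"
    and add_commute: "\<lbrakk>x \<in> lcarrier L; y \<in> lcarrier L\<rbrakk> \<Longrightarrow> ladd L x y = ladd L y x"
    and add_zero: "x \<in> lcarrier L \<Longrightarrow> ladd L x (lzero L) = x"
    and add_inverse: "x \<in> lcarrier L \<Longrightarrow> \<exists>y\<in>lcarrier L. ladd L x y = lzero L"
    and scale_add_right: "\<lbrakk>x \<in> lcarrier L; y \<in> lcarrier L\<rbrakk> \<Longrightarrow>
      lscale L c (ladd L x y) = ladd L (lscale L c x) (lscale L c y)"
    and scale_add_left: "x \<in> lcarrier L \<Longrightarrow>
      lscale L (c + d) x = ladd L (lscale L c x) (lscale L d x)"
    and scale_scale: "x \<in> lcarrier L \<Longrightarrow> lscale L c (lscale L d x) = lscale L (c * d) x"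
    and scale_one: "x \<in> lcarrier L \<Longrightarrow> lscale L 1 x = x"
    and bracket_add_left: "\<lbrakk>x \<in> lcarrier L; y \<in> lcarrier L; z \<in> lcarrier L\<rbrakk> \<Longrightarrow>
      lbracket L (ladd L x y) z = ladd L (lbracket L x z) (lbracket L y z)"
    and bracket_add_right: "\<lbrakk>x \<in> lcarrier L; y \<in> lcarrier L; z \<in> lcarrier L\<rbrakk> \<Longrightarrow>
      lbracket L x (ladd L y z) = ladd L (lbracket L x y) (lbracket L x z)"
    and bracket_scale_left: "\<lbrakk>x \<in> lcarrier L; y \<in> lcarrier L\<rbrakk> \<Longrightarrow>
      lbracket L (lscale L c x) y = lscale L c (lbracket L x y)"
    and bracket_scale_right: "\<lbrakk>x \<in> lcarrier L; y \<in> lcarrier L\<rbrakk> \<Longrightarrow>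
      lbracket L x (lscale L c y) = lscale L c (lbracket L x y)"
    and bracket_self: "x \<in> lcarrier L \<Longrightarrow> lbracket L x x = lzero L"
    and jacobi: "\<lbrakk>x \<in> lcarrier L; y \<in> lcarrier L; z \<in> lcarrier L\<rbrakk> \<Longrightarrow>
      ladd L (lbracket L x (lbracket L y z))
        (ladd L (lbracket L y (lbracket L z x)) (lbracket L z (lbracket L x y))) = lzero L"

definition lie_subspace :: "('k::field, 'l) lie_structure \<Rightarrow> 'l set \<Rightarrow> bool" where
  "lie_subspace L W \<longleftrightarrow> W \<subseteq> lcarrier L \<and> lzero L \<in> W \<and>
     (\<forall>x\<in>W. \<forall>y\<in>W. ladd L x y \<in> W) \<and> (\<forall>c. \<forall>x\<in>W. lscale L c x \<in> W)"

definition lie_derived :: "('k::field, 'l) lie_structure \<Rightarrow> 'l set \<Rightarrow> 'l set" where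
  "lie_derived L S = \<Inter>{W. lie_subspace L W \<and> (\<forall>x\<in>S. \<forall>y\<in>S. lbracket L x y \<in> W)}"

primrec lie_derived_series :: "('k::field, 'l) lie_structure \<Rightarrow> nat \<Rightarrow> 'l set" where
  "lie_derived_series L 0 = lcarrier L"
| "lie_derived_series L (Suc n) = lie_derived L (lie_derived_series L n)"

definition solvable_lie_algebra :: "('k::field, 'l) lie_structure \<Rightarrow> bool" where
  "solvable_lie_algebra L \<longleftrightarrow> lie_algebra L \<and> (\<exists>n. lie_derived_series L n = {lzero L})"

definition lie_coset :: "('k::field, 'l) lie_structure \<Rightarrow> 'l set \<Rightarrow> 'l \<Rightarrow> 'l set" where
  "lie_coset L I x = {ladd L x i | i. i \<in> I}"

text \<open>As for quotient rings, the operations on cosets are unions over all representatives.\<close>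

definition lie_quotient ::
    "('k::field, 'l) lie_structure \<Rightarrow> 'l set \<Rightarrow> ('k, 'l set) lie_structure" where
  "lie_quotient L I =
     \<lparr>lcarrier = lie_coset L I ` lcarrier L,
      lzero = lie_coset L I (lzero L),
      ladd = (\<lambda>X Y. \<Union>x\<in>X. \<Union>y\<in>Y. lie_coset L I (ladd L x y)),
      lscale = (\<lambda>c X. \<Union>x\<in>X. lie_coset L I (lscale L c x)),
      lbracket = (\<lambda>X Y. \<Union>x\<in>X. \<Union>y\<in>Y. lie_coset L I (lbracket L x y))\<rparr>"

section \<open>Relative first Hochschild cohomology\<close>

definition derivation :: "('k::field \<Rightarrow> 'a::ring_1 \<Rightarrow> 'a) \<Rightarrow> ('a \<Rightarrow> 'a) \<Rightarrow> bool" where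
  "derivation scale D \<longleftrightarrow>
     Vector_Spaces.linear scale scale D \<and> (\<forall>x y. D (x * y) = D x * y + x * D y)"

definition bimodule_hom :: "'a::ring_1 set \<Rightarrow> ('a \<Rightarrow> 'a) \<Rightarrow> bool" where
  "bimodule_hom B D \<longleftrightarrow> (\<forall>x y. D (x + y) = D x + D y) \<and>
     (\<forall>b\<in>B. \<forall>x. D (b * x) = b * D x \<and> D (x * b) = D x * b)"

definition rel_derivations :: "('k::field \<Rightarrow> 'a::ring_1 \<Rightarrow> 'a) \<Rightarrow> 'a set \<Rightarrow> ('a \<Rightarrow> 'a) set" where
  "rel_derivations scale B = {D. derivation scale D \<and> bimodule_hom B D}"

definition rel_inner_derivations ::
    "('k::field \<Rightarrow> 'a::ring_1 \<Rightarrow> 'a) \<Rightarrow> 'a set \<Rightarrow> ('a \<Rightarrow> 'a) set" where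
  "rel_inner_derivations scale B =
     {D \<in> rel_derivations scale B. \<exists>a. \<forall>x. D x = a * x - x * a}"

definition rel_derivation_lie ::
    "('k::field \<Rightarrow> 'a::ring_1 \<Rightarrow> 'a) \<Rightarrow> 'a set \<Rightarrow> ('k, 'a \<Rightarrow> 'a) lie_structure" where
  "rel_derivation_lie scale B =
     \<lparr>lcarrier = rel_derivations scale B,
      lzero = (\<lambda>x. 0),
      ladd = (\<lambda>D D' x. D x + D' x),
      lscale = (\<lambda>c D x. scale c (D x)),
      lbracket = (\<lambda>D D' x. D (D' x) - D' (D x))\<rparr>"

definition rel_HH1 ::
    "('k::field \<Rightarrow> 'a::ring_1 \<Rightarrow> 'a) \<Rightarrow> 'a set \<Rightarrow> ('k, ('a \<Rightarrow> 'a) set) lie_structure" where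
  "rel_HH1 scale B = lie_quotient (rel_derivation_lie scale B) (rel_inner_derivations scale B)"

end

theory Submission
  imports Defs
begin

text \<open>
  Let \<open>R n\<close> be the image in \<open>A\<close> of the \<open>n\<close>-th power of the arrow ideal. A \<open>B\<close>-relative derivation kills
  the vertices and the arrows of \<open>Q\<^sub>B\<close>, so it is determined by its values on the arrows of \<open>Q\<^sub>C\<close>. In
  characteristic zero it maps arrows into \<open>R 1\<close> and hence preserves the filtration. As \<open>Q\<^sub>C\<close> has no parallel
  arrows, it sends an arrow \<open>a\<close> of \<open>Q\<^sub>C\<close> to a multiple of \<open>a\<close> modulo \<open>V = B + R 2\<close>, and it maps \<open>V\<close> into \<open>R 2\<close>.
  Therefore a bracket of derivations maps the arrows of \<open>Q\<^sub>C\<close> into \<open>V\<close>, a bracket of such brackets maps all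
  arrows into \<open>R 2\<close>, and from then on each derived step raises the filtration degree, until the
  nilpotency of \<open>R\<close> forces zero. So already the Lie algebra of \<open>B\<close>-relative derivations is solvable.
\<close>

section \<open>Quotients of Lie algebras and solvability\<close>

text \<open>Both orders of the bracket are demanded because \<open>lie_algebra\<close> states only
  \<open>bracket_self\<close>; antisymmetry then never has to be derived.\<close>

definition lie_ideal :: "('k::field, 'l) lie_structure \<Rightarrow> 'l set \<Rightarrow> bool" where
  "lie_ideal L I \<longleftrightarrow> lie_subspace L I \<and>
     (\<forall>x\<in>lcarrier L. \<forall>i\<in>I. lbracket L x i \<in> I \<and> lbracket L i x \<in> I)"

lemma lie_subspaceD:
  assumes "lie_subspace L W"
  shows "x \<in> W \<Longrightarrow> x \<in> lcarrier L" "lzero L \<in> W"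
    "x \<in> W \<Longrightarrow> y \<in> W \<Longrightarrow> ladd L x y \<in> W" "x \<in> W \<Longrightarrow> lscale L c x \<in> W"
  using assms by (auto simp: lie_subspace_def)

lemma lie_idealD:
  assumes "lie_ideal L I"
  shows "lie_subspace L I"
    "x \<in> lcarrier L \<Longrightarrow> i \<in> I \<Longrightarrow> lbracket L x i \<in> I"
    "x \<in> lcarrier L \<Longrightarrow> i \<in> I \<Longrightarrow> lbracket L i x \<in> I"
  using assms by (auto simp: lie_ideal_def)

context lie_algebra
begin

abbreviation lie_add (infixl "\<oplus>" 65) where "x \<oplus> y \<equiv> ladd L x y"

lemma add_left_commute:
  "\<lbrakk>x \<in> lcarrier L; y \<in> lcarrier L; z \<in> lcarrier L\<rbrakk> \<Longrightarrow> x \<oplus> (y \<oplus> z) = y \<oplus> (x \<oplus> z)"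
  by (metis add_assoc add_commute)

lemma scale_zero_left:
  assumes "x \<in> lcarrier L"
  shows "lscale L 0 x = lzero L"
proof -
  define z where "z = lscale L 0 x"
  have z: "z \<in> lcarrier L" and idem: "z \<oplus> z = z"
    using assms scale_closed scale_add_left[of x 0 0] by (auto simp: z_def)
  obtain w where w: "w \<in> lcarrier L" "z \<oplus> w = lzero L"
    using add_inverse z by blast
  have "z = z \<oplus> (z \<oplus> w)" using w z add_zero by simp
  also have "\<dots> = lzero L" using w z idem add_assoc[of z z w] by simp
  finally show ?thesis by (simp add: z_def)
qed

lemma add_scale_minus_one: "x \<in> lcarrier L \<Longrightarrow> x \<oplus> lscale L (- 1) x = lzero L"
  using scale_add_left[of x 1 "- 1"] by (simp add: scale_one scale_zero_left)

text \<open>\<open>lie_derived\<close> yields the least subspace containing the brackets, so by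
  induction the derived series stays inside \<open>T\<close>. A chain with an explicit description
  can thus replace the derived series.\<close>

lemma solvable_by_chain:
  assumes "T 0 = lcarrier L" and "\<And>n. lie_subspace L (T n)"
    and "\<And>n x y. x \<in> T n \<Longrightarrow> y \<in> T n \<Longrightarrow> lbracket L x y \<in> T (Suc n)"
    and "T N = {lzero L}"
  shows "solvable_lie_algebra L"
proof -
  have "lie_derived_series L n \<subseteq> T n" for n
  proof (induction n)
    case (Suc n)
    then show ?case using assms(2,3) by (fastforce simp: lie_derived_def)
  qed (simp add: assms(1))
  moreover have "lzero L \<in> lie_derived_series L n" for n
    by (cases n) (auto simp: zero_closed lie_derived_def lie_subspace_def)
  ultimately have "lie_derived_series L N = {lzero L}"
    using assms(4) by blast
  then show ?thesis
    unfolding solvable_lie_algebra_def using lie_algebra_axioms by blast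
qed

section \<open>The quotient of a Lie algebra by an ideal\<close>

context
  fixes I assumes I: "lie_ideal L I"
begin

lemmas I_subspace = lie_subspaceD[OF lie_idealD(1)[OF I]]

lemma self_in_lie_coset: "x \<in> lcarrier L \<Longrightarrow> x \<in> lie_coset L I x"
  using I_subspace(2) add_zero by (force simp: lie_coset_def)

lemma lie_coset_eq:
  assumes x: "x \<in> lcarrier L" and y: "y \<in> lie_coset L I x"
  shows "lie_coset L I y = lie_coset L I x"
proof -
  obtain i where i: "i \<in> I" "y = x \<oplus> i" using y by (auto simp: lie_coset_def)
  have "y \<oplus> j \<in> lie_coset L I x" if "j \<in> I" for j
    using that x i I_subspace by (auto simp: lie_coset_def add_assoc)
  \<comment> \<open>Since \<open>x\<close> is \<open>y - i\<close>, the element \<open>x + j\<close>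
    is the translate of \<open>y\<close> by \<open>j - i\<close>.\<close>
  moreover have "x \<oplus> j \<in> lie_coset L I y" if j: "j \<in> I" for j
  proof -
    let ?i = "lscale L (- 1) i"
    have "x \<oplus> j = x \<oplus> ((i \<oplus> ?i) \<oplus> j)"
      using add_scale_minus_one i j I_subspace x add_zero add_commute zero_closed by metis
    also have "\<dots> = y \<oplus> (?i \<oplus> j)"
      using i j x I_subspace by (simp add: add_assoc add_closed)
    finally show ?thesis using i j I_subspace by (auto simp: lie_coset_def)
  qed
  ultimately show ?thesis by (auto simp: lie_coset_def)
qed

text \<open>The operations of \<open>lie_quotient\<close> are unions over all representatives. Once
  every value falls into one coset, all the cosets in the union coincide, and the union collapses
  because the index set is nonempty.\<close>

lemma UN_lie_coset:
  assumes "z \<in> lcarrier L" "X \<noteq> {}" "\<And>x. x \<in> X \<Longrightarrow> f x \<in> lie_coset L I z"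
  shows "(\<Union>x\<in>X. lie_coset L I (f x)) = lie_coset L I z"
proof -
  have "lie_coset L I (f x) = lie_coset L I z" if "x \<in> X" for x
    by (rule lie_coset_eq[OF assms(1) assms(3)[OF that]])
  then have "(\<Union>x\<in>X. lie_coset L I (f x)) = (\<Union>x\<in>X. lie_coset L I z)"
    by (rule SUP_cong[OF refl])
  then show ?thesis using assms(2) by simp
qed

lemma UN_lie_coset2:
  assumes "z \<in> lcarrier L" "X \<noteq> {}" "Y \<noteq> {}"
    "\<And>x y. x \<in> X \<Longrightarrow> y \<in> Y \<Longrightarrow> f x y \<in> lie_coset L I z"
  shows "(\<Union>x\<in>X. \<Union>y\<in>Y. lie_coset L I (f x y)) = lie_coset L I z"
proof -
  have "(\<Union>x\<in>X. \<Union>y\<in>Y. lie_coset L I (f x y)) = (\<Union>x\<in>X. lie_coset L I z)"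
    by (rule SUP_cong[OF refl UN_lie_coset[OF assms(1,3,4)]])
  then show ?thesis using assms(2) by simp
qed

lemma lie_quotient_add:
  assumes x: "x \<in> lcarrier L" and y: "y \<in> lcarrier L"
  shows "ladd (lie_quotient L I) (lie_coset L I x) (lie_coset L I y) = lie_coset L I (x \<oplus> y)"
proof -
  have "x' \<oplus> y' \<in> lie_coset L I (x \<oplus> y)"
    if "x' \<in> lie_coset L I x" "y' \<in> lie_coset L I y" for x' y'
  proof -
    obtain i j where ij: "i \<in> I" "j \<in> I" "x' = x \<oplus> i" "y' = y \<oplus> j"
      using \<open>x' \<in> lie_coset L I x\<close> \<open>y' \<in> lie_coset L I y\<close> by (auto simp: lie_coset_def)
    have "x' \<oplus> y' = (x \<oplus> y) \<oplus> (i \<oplus> j)"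
      using x y ij I_subspace by (simp add: add_assoc add_left_commute add_closed)
    then show ?thesis using ij I_subspace by (auto simp: lie_coset_def)
  qed
  then show ?thesis
    using self_in_lie_coset[OF x] self_in_lie_coset[OF y] unfolding lie_quotient_def
    by (simp, intro UN_lie_coset2 add_closed x y) auto
qed

lemma lie_quotient_scale:
  assumes x: "x \<in> lcarrier L"
  shows "lscale (lie_quotient L I) c (lie_coset L I x) = lie_coset L I (lscale L c x)"
proof -
  have "lscale L c x' \<in> lie_coset L I (lscale L c x)" if "x' \<in> lie_coset L I x" for x'
    using that x I_subspace by (auto simp: lie_coset_def scale_add_right)
  then show ?thesis
    using UN_lie_coset[of "lscale L c x" "lie_coset L I x" "lscale L c"]
      self_in_lie_coset[OF x] scale_closed[OF x]
    by (auto simp: lie_quotient_def)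
qed

lemma lie_quotient_bracket:
  assumes x: "x \<in> lcarrier L" and y: "y \<in> lcarrier L"
  shows "lbracket (lie_quotient L I) (lie_coset L I x) (lie_coset L I y) =
    lie_coset L I (lbracket L x y)"
proof -
  have "lbracket L x' y' \<in> lie_coset L I (lbracket L x y)"
    if "x' \<in> lie_coset L I x" "y' \<in> lie_coset L I y" for x' y'
  proof -
    obtain i j where ij: "i \<in> I" "j \<in> I" "x' = x \<oplus> i" "y' = y \<oplus> j"
      using \<open>x' \<in> lie_coset L I x\<close> \<open>y' \<in> lie_coset L I y\<close> by (auto simp: lie_coset_def)
    note cl = ij(1,2) x y add_closed bracket_closed I_subspace(1)
    \<comment> \<open>Of the four terms of the expanded bracket, the three containing
      \<open>i\<close> or \<open>j\<close> lie in the ideal.\<close>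
    have "lbracket L x' y' = lbracket L x y \<oplus> (lbracket L x j \<oplus> (lbracket L i y \<oplus> lbracket L i j))"
      using cl by (simp add: ij(3,4) bracket_add_left bracket_add_right add_assoc add_left_commute)
    moreover have "lbracket L x j \<oplus> (lbracket L i y \<oplus> lbracket L i j) \<in> I"
      using cl by (intro I_subspace(3) lie_idealD(2,3)[OF I]) auto
    ultimately show ?thesis by (auto simp: lie_coset_def)
  qed
  then show ?thesis
    using self_in_lie_coset[OF x] self_in_lie_coset[OF y] unfolding lie_quotient_def
    by (simp, intro UN_lie_coset2 bracket_closed x y) auto
qed

lemma lie_quotient_carrier: "lcarrier (lie_quotient L I) = lie_coset L I ` lcarrier L"
  and lie_quotient_zero: "lzero (lie_quotient L I) = lie_coset L I (lzero L)"
  by (auto simp: lie_quotient_def)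

lemmas lie_quotient_simps = lie_quotient_carrier lie_quotient_zero lie_quotient_add
  lie_quotient_scale lie_quotient_bracket

lemmas closed = zero_closed add_closed scale_closed bracket_closed

lemma lie_algebra_quotient: "lie_algebra (lie_quotient L I)"
proof
  let ?Q = "lie_quotient L I"
  show "lzero ?Q \<in> lcarrier ?Q"
    by (simp add: lie_quotient_simps zero_closed)
  fix x y assume "x \<in> lcarrier ?Q" "y \<in> lcarrier ?Q"
  then obtain u v where x: "u \<in> lcarrier L" "x = lie_coset L I u"
    and y: "v \<in> lcarrier L" "y = lie_coset L I v"
    by (auto simp: lie_quotient_carrier)
  show "ladd ?Q x y \<in> lcarrier ?Q" "lbracket ?Q x y \<in> lcarrier ?Q"
    "lscale ?Q c x \<in> lcarrier ?Q" for c
    using x y by (simp_all add: lie_quotient_simps closed)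
  show "ladd ?Q x y = ladd ?Q y x" "ladd ?Q x (lzero ?Q) = x"
    "lbracket ?Q x x = lzero ?Q"
    using x y add_commute[of u v]
    by (simp_all add: lie_quotient_simps closed add_zero bracket_self)
  have "ladd ?Q x (lie_coset L I (lscale L (- 1) u)) = lzero ?Q"
    using x by (simp add: lie_quotient_simps closed add_scale_minus_one)
  moreover have "lie_coset L I (lscale L (- 1) u) \<in> lcarrier ?Q"
    using x by (simp add: lie_quotient_simps closed)
  ultimately show "\<exists>y\<in>lcarrier ?Q. ladd ?Q x y = lzero ?Q" ..
  show "lscale ?Q c (ladd ?Q x y) = ladd ?Q (lscale ?Q c x) (lscale ?Q c y)"
    "lscale ?Q (c + d) x = ladd ?Q (lscale ?Q c x) (lscale ?Q d x)"
    "lscale ?Q c (lscale ?Q d x) = lscale ?Q (c * d) x" "lscale ?Q 1 x = x"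
    "lbracket ?Q (lscale ?Q c x) y = lscale ?Q c (lbracket ?Q x y)"
    "lbracket ?Q x (lscale ?Q c y) = lscale ?Q c (lbracket ?Q x y)" for c d
    using x y by (simp_all add: lie_quotient_simps closed scale_add_right scale_add_left
        scale_scale scale_one bracket_scale_left bracket_scale_right)
  fix z assume "z \<in> lcarrier ?Q"
  then obtain w where z: "w \<in> lcarrier L" "z = lie_coset L I w"
    by (auto simp: lie_quotient_carrier)
  show "ladd ?Q (ladd ?Q x y) z = ladd ?Q x (ladd ?Q y z)"
    "lbracket ?Q (ladd ?Q x y) z = ladd ?Q (lbracket ?Q x z) (lbracket ?Q y z)"
    "lbracket ?Q x (ladd ?Q y z) = ladd ?Q (lbracket ?Q x y) (lbracket ?Q x z)"
    "ladd ?Q (lbracket ?Q x (lbracket ?Q y z))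
        (ladd ?Q (lbracket ?Q y (lbracket ?Q z x)) (lbracket ?Q z (lbracket ?Q x y))) = lzero ?Q"
    using x y z by (simp_all add: lie_quotient_simps closed add_assoc bracket_add_left
        bracket_add_right jacobi)
qed

text \<open>The projection respects all operations, so the images of the \<open>T n\<close> form a
  chain of the same kind in the quotient. This reduces the work to the Lie algebra of derivations,
  where elements are actual maps.\<close>

lemma lie_quotient_solvable_by_chain:
  assumes T: "T 0 = lcarrier L" "\<And>n. lie_subspace L (T n)"
    and br: "\<And>n x y. x \<in> T n \<Longrightarrow> y \<in> T n \<Longrightarrow> lbracket L x y \<in> T (Suc n)"
    and N: "T N = {lzero L}"
  shows "solvable_lie_algebra (lie_quotient L I)"
proof -
  note D = lie_subspaceD[OF T(2)]
  interpret Q: lie_algebra "lie_quotient L I" by (rule lie_algebra_quotient)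
  show ?thesis
  proof (rule Q.solvable_by_chain)
    show "lie_coset L I ` T 0 = lcarrier (lie_quotient L I)"
      by (simp add: T(1) lie_quotient_simps)
    show "lie_subspace (lie_quotient L I) (lie_coset L I ` T n)" for n
      using D(1)[of _ n] D(2-4) unfolding lie_subspace_def
      by (auto simp: lie_quotient_simps)
    show "lbracket (lie_quotient L I) x y \<in> lie_coset L I ` T (Suc n)"
      if "x \<in> lie_coset L I ` T n" "y \<in> lie_coset L I ` T n" for n x y
      using that br D(1)[of _ n] by (auto simp: lie_quotient_simps)
    show "lie_coset L I ` T N = {lzero (lie_quotient L I)}"
      by (simp add: N lie_quotient_simps)
  qed
qed

end

end

section \<open>The Lie algebra of relative derivations\<close>

context assoc_algebra
begin

text \<open>The bimodule rule gives \<open>D (b * 1) = b * D 1\<close>, the Leibniz rule gives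
  \<open>D b + b * D 1\<close>, hence \<open>D b = 0\<close>. Conversely, with
  \<open>D b = 0\<close> the Leibniz rule becomes the bimodule rule.\<close>

lemma rel_derivation_iff:
  "D \<in> rel_derivations scale B \<longleftrightarrow>
    (\<forall>x y. D (x + y) = D x + D y) \<and> (\<forall>c x. D (scale c x) = scale c (D x)) \<and>
    (\<forall>x y. D (x * y) = D x * y + x * D y) \<and> (\<forall>b\<in>B. D b = 0)"
    (is "_ \<longleftrightarrow> ?add \<and> ?scale \<and> ?leibniz \<and> ?zero")
proof -
  have lin: "Vector_Spaces.linear scale scale D \<longleftrightarrow> ?add \<and> ?scale"
    unfolding Vector_Spaces.linear_iff using vector_space_axioms by blast
  have "bimodule_hom B D \<longleftrightarrow> ?zero" if ?add ?leibniz
  proof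
    assume hom: "bimodule_hom B D"
    show ?zero
    proof
      fix b assume "b \<in> B"
      then have "D (1 * b) = D 1 * b" "D (b * 1) = b * D 1"
        using hom unfolding bimodule_hom_def by blast+
      moreover have "D (b * 1) = D b * 1 + b * D 1" using that(2) by blast
      ultimately show "D b = 0" by simp
    qed
  next
    assume zero: ?zero
    have "D (b * x) = b * D x \<and> D (x * b) = D x * b" if "b \<in> B" for b x
    proof -
      have "D b = 0" using zero that by blast
      moreover have "D (b * x) = D b * x + b * D x" "D (x * b) = D x * b + x * D b"
        using \<open>?leibniz\<close> by blast+
      ultimately show ?thesis by simp
    qed
    then show "bimodule_hom B D" unfolding bimodule_hom_def using \<open>?add\<close> by blast
  qed
  then show ?thesis
    unfolding rel_derivations_def derivation_def mem_Collect_eq lin by blast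
qed

lemma rel_derivationD:
  assumes "D \<in> rel_derivations scale B"
  shows "D (x + y) = D x + D y" "D (scale c x) = scale c (D x)"
    "D (x * y) = D x * y + x * D y" "b \<in> B \<Longrightarrow> D b = 0" "D 0 = 0" "D (x - y) = D x - D y"
proof -
  have a: "D (x + y) = D x + D y" for x y using assms unfolding rel_derivation_iff by auto
  then show "D (x + y) = D x + D y" .
  show "D (scale c x) = scale c (D x)"
    "D (x * y) = D x * y + x * D y" "b \<in> B \<Longrightarrow> D b = 0"
    using assms unfolding rel_derivation_iff by auto
  show "D 0 = 0" using a[of 0 0] by simp
  show "D (x - y) = D x - D y" using a[of "x - y" y] by simp
qed

lemma lie_algebra_rel_derivations: "lie_algebra (rel_derivation_lie scale B)"
proof
  let ?L = "rel_derivation_lie scale B"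
  note ops = rel_derivation_lie_def
  show "lzero ?L \<in> lcarrier ?L"
    by (simp add: ops rel_derivation_iff)
  fix D F assume DF: "D \<in> lcarrier ?L" "F \<in> lcarrier ?L"
  then have D: "D \<in> rel_derivations scale B" and F: "F \<in> rel_derivations scale B"
    by (simp_all add: ops)
  note der = rel_derivationD[OF D] rel_derivationD[OF F]
  show "\<exists>y\<in>lcarrier ?L. ladd ?L D y = lzero ?L"
    by (rule bexI[of _ "\<lambda>x. - D x"]) (simp_all add: ops rel_derivation_iff der)
  show "ladd ?L D F \<in> lcarrier ?L"
    by (simp add: ops rel_derivation_iff der algebra_simps scale_right_distrib)
  show "lscale ?L c D \<in> lcarrier ?L" for c
    by (simp add: ops rel_derivation_iff der scale_right_distrib scale_mult_left mult_scale_right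
        mult.commute)
  show "lbracket ?L D F \<in> lcarrier ?L"
    by (simp add: ops rel_derivation_iff der algebra_simps scale_right_diff_distrib)
  show "ladd ?L D F = ladd ?L F D" by (simp add: ops add.commute)
  show "ladd ?L D (lzero ?L) = D" by (simp add: ops)
  show "lscale ?L c (ladd ?L D F) = ladd ?L (lscale ?L c D) (lscale ?L c F)"
    "lscale ?L (c + d) D = ladd ?L (lscale ?L c D) (lscale ?L d D)"
    "lscale ?L c (lscale ?L d D) = lscale ?L (c * d) D" "lscale ?L 1 D = D" for c d
    by (simp_all add: ops scale_right_distrib scale_left_distrib)
  show "lbracket ?L (lscale ?L c D) F = lscale ?L c (lbracket ?L D F)"
    "lbracket ?L D (lscale ?L c F) = lscale ?L c (lbracket ?L D F)" for c
    by (simp_all add: ops der scale_right_diff_distrib)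
  show "lbracket ?L D D = lzero ?L" by (simp add: ops)
  fix G assume "G \<in> lcarrier ?L"
  then have "G \<in> rel_derivations scale B" by (simp add: ops)
  note der = der rel_derivationD[OF this]
  show "ladd ?L (ladd ?L D F) G = ladd ?L D (ladd ?L F G)"
    "lbracket ?L (ladd ?L D F) G = ladd ?L (lbracket ?L D G) (lbracket ?L F G)"
    "lbracket ?L D (ladd ?L F G) = ladd ?L (lbracket ?L D F) (lbracket ?L D G)"
    "ladd ?L (lbracket ?L D (lbracket ?L F G))
        (ladd ?L (lbracket ?L F (lbracket ?L G D)) (lbracket ?L G (lbracket ?L D F))) = lzero ?L"
    by (simp_all add: ops der algebra_simps)
qed

text \<open>If \<open>F\<close> is the inner derivation of \<open>a\<close>, then the bracket of
  \<open>D\<close> and \<open>F\<close> is the inner derivation of \<open>D a\<close>.\<close>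

lemma lie_ideal_rel_inner_derivations:
  "lie_ideal (rel_derivation_lie scale B) (rel_inner_derivations scale B)"
proof -
  interpret L: lie_algebra "rel_derivation_lie scale B" by (rule lie_algebra_rel_derivations)
  let ?L = "rel_derivation_lie scale B" and ?I = "rel_inner_derivations scale B"
  have I: "D \<in> ?I \<longleftrightarrow> D \<in> lcarrier ?L \<and> (\<exists>a. \<forall>x. D x = a * x - x * a)" for D
    by (simp add: rel_inner_derivations_def rel_derivation_lie_def)
  note ops = rel_derivation_lie_def
  have br: "lbracket ?L D F \<in> ?I \<and> lbracket ?L F D \<in> ?I" if D: "D \<in> lcarrier ?L" and F: "F \<in> ?I" for D F
  proof -
    obtain a where a: "\<forall>x. F x = a * x - x * a" using F unfolding I by blast
    have D': "D \<in> rel_derivations scale B" using D by (simp add: ops)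
    have "lbracket ?L D F x = D a * x - x * D a" for x
      by (simp add: ops a rel_derivationD[OF D'] algebra_simps)
    moreover have "lbracket ?L F D x = (- D a) * x - x * (- D a)" for x
      by (simp add: ops a rel_derivationD[OF D'] algebra_simps)
    ultimately show ?thesis using L.bracket_closed D F unfolding I by blast
  qed
  have "\<forall>x. lzero ?L x = 0 * x - x * 0" by (simp add: ops)
  then have "lzero ?L \<in> ?I" using L.zero_closed unfolding I by blast
  moreover have "ladd ?L D F \<in> ?I" if DF: "D \<in> ?I" "F \<in> ?I" for D F
  proof -
    obtain a b where "\<forall>x. D x = a * x - x * a" "\<forall>x. F x = b * x - x * b"
      using DF unfolding I by blast
    then have "ladd ?L D F x = (a + b) * x - x * (a + b)" for x
      by (simp add: ops algebra_simps)
    then show ?thesis using L.add_closed that unfolding I by blast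
  qed
  moreover have "lscale ?L c D \<in> ?I" if D: "D \<in> ?I" for c D
  proof -
    obtain a where "\<forall>x. D x = a * x - x * a" using D unfolding I by blast
    then have "lscale ?L c D x = scale c a * x - x * scale c a" for x
      by (simp add: ops scale_mult_left mult_scale_right scale_right_diff_distrib)
    then show ?thesis using L.scale_closed that unfolding I by blast
  qed
  moreover have "?I \<subseteq> lcarrier ?L" using I by blast
  ultimately show ?thesis
    using br unfolding lie_ideal_def lie_subspace_def by blast
qed

end

section \<open>Derivations and the arrow filtration\<close>

text \<open>Being a subspace, this set equals the whole algebra (or contains a layer of the
  filtration) as soon as it contains suitable generators. This is how a corner is shown to be
  spanned by \<open>u\<close> modulo \<open>U\<close>.\<close>

lemma (in assoc_algebra) subspace_corner:
  assumes "subspace U"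
  shows "subspace {y. \<exists>c. p * y * q - scale c u \<in> U}"
proof (rule subspaceI; clarify)
  show "\<exists>c. p * 0 * q - scale c u \<in> U"
    using subspace_0[OF assms] by (intro exI[of _ 0]) simp
next
  fix x y c d assume "p * x * q - scale c u \<in> U" "p * y * q - scale d u \<in> U"
  from subspace_add[OF assms this] have "p * (x + y) * q - scale (c + d) u \<in> U"
    by (simp add: algebra_simps)
  then show "\<exists>c. p * (x + y) * q - scale c u \<in> U" ..
next
  fix d x c assume "p * x * q - scale c u \<in> U"
  from subspace_scale[OF assms this, of d] have "p * scale d x * q - scale (d * c) u \<in> U"
    by (simp add: scale_mult_left mult_scale_right scale_right_diff_distrib)
  then show "\<exists>c. p * scale d x * q - scale c u \<in> U" ..
qed

text \<open>The situation without path algebras: \<open>R n\<close> stands for the image of the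
  \<open>n\<close>-th power of the arrow ideal and \<open>S\<close> for the arrows of the smaller
  quiver. The assumptions \<open>generated\<close> and \<open>R_Suc_generated\<close> serve as
  induction principles in place of expansions into paths.\<close>

locale arrow_filtration = assoc_algebra scale
  for scale :: "'k::field_char_0 \<Rightarrow> 'a::ring_1 \<Rightarrow> 'a" +
  fixes Q :: "('v, 'e) pre_digraph" and e :: "'v \<Rightarrow> 'a" and \<xi> :: "'e \<Rightarrow> 'a"
    and R :: "nat \<Rightarrow> 'a set" and N :: nat and B :: "'a set" and S :: "'e set"
  assumes wf: "wf_digraph Q"
    and idem: "\<And>v. v \<in> verts Q \<Longrightarrow> e v * e v = e v"
    and orth: "\<And>v w. v \<in> verts Q \<Longrightarrow> w \<in> verts Q \<Longrightarrow> v \<noteq> w \<Longrightarrow> e v * e w = 0"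
    and tail_arrow: "\<And>a. a \<in> arcs Q \<Longrightarrow> e (tail Q a) * \<xi> a = \<xi> a"
    and arrow_head: "\<And>a. a \<in> arcs Q \<Longrightarrow> \<xi> a * e (head Q a) = \<xi> a"
    and arrow_R: "\<And>a. a \<in> arcs Q \<Longrightarrow> \<xi> a \<in> R 1"
    and R_subspace: "\<And>n. subspace (R n)"
    and R_mult: "\<And>m n y z. y \<in> R m \<Longrightarrow> z \<in> R n \<Longrightarrow> y * z \<in> R (m + n)"
    and R_0: "R 0 = UNIV"
    and R_antimono: "\<And>m n. m \<le> n \<Longrightarrow> R n \<subseteq> R m"
    and R_nilpotent: "R N = {0}"
    and vertex_not_R: "\<And>v. v \<in> verts Q \<Longrightarrow> e v \<notin> R 1"
    and generated: "\<And>W. subspace W \<Longrightarrow> (\<And>v. v \<in> verts Q \<Longrightarrow> e v \<in> W) \<Longrightarrow>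
      (\<And>a y. a \<in> arcs Q \<Longrightarrow> y \<in> W \<Longrightarrow> \<xi> a * y \<in> W) \<Longrightarrow> W = UNIV"
    and R_Suc_generated: "\<And>W n. subspace W \<Longrightarrow>
      (\<And>a y. a \<in> arcs Q \<Longrightarrow> y \<in> R n \<Longrightarrow> \<xi> a * y \<in> W) \<Longrightarrow> R (Suc n) \<subseteq> W"
    and B_subspace: "subspace B"
    and vertex_B: "\<And>v. v \<in> verts Q \<Longrightarrow> e v \<in> B"
    and arrow_B: "\<And>a. a \<in> S \<Longrightarrow> \<xi> a \<in> B"
    and not_parallel: "\<And>a b. a \<in> arcs Q - S \<Longrightarrow> b \<in> arcs Q - S \<Longrightarrow>
      tail Q a = tail Q b \<Longrightarrow> head Q a = head Q b \<Longrightarrow> a = b"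
begin

abbreviation "Der \<equiv> rel_derivations scale B"

text \<open>An arrow outside \<open>S\<close> may be parallel to arrows in \<open>S\<close>, so its
  image under a derivation is controlled only modulo \<open>B\<close> as well as \<open>R 2\<close>.
  The summand \<open>B\<close> does no harm, since derivations in \<open>Der\<close> kill
  it.\<close>

definition V :: "'a set" where "V = {b + r | b r. b \<in> B \<and> r \<in> R 2}"

lemmas R_0_mem = subspace_0[OF R_subspace]
  and R_add = subspace_add[OF R_subspace]
  and R_diff = subspace_diff[OF R_subspace]
  and R_scale = subspace_scale[OF R_subspace]

lemma R_ideal: "y \<in> R n \<Longrightarrow> z * y \<in> R n" "y \<in> R n \<Longrightarrow> y * z \<in> R n"
  using R_mult[of z 0 y n] R_mult[of y n z 0] by (auto simp: R_0)

lemma tail_in_verts: "a \<in> arcs Q \<Longrightarrow> tail Q a \<in> verts Q"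
  and head_in_verts: "a \<in> arcs Q \<Longrightarrow> head Q a \<in> verts Q"
  using wf by (auto simp: wf_digraph_def)

lemma V_subspace: "subspace V"
  unfolding V_def by (rule subspace_sums[OF B_subspace R_subspace])

lemma B_V: "b \<in> B \<Longrightarrow> b \<in> V"
  unfolding V_def using R_0_mem[of 2] by force

lemma R_V: "r \<in> R 2 \<Longrightarrow> r \<in> V"
  unfolding V_def using subspace_0[OF B_subspace] by force

section \<open>The effect of relative derivations on the filtration\<close>

lemma subspace_preimage:
  assumes "D \<in> Der" "subspace W"
  shows "subspace {y. D y \<in> W}"
  using assms(2) unfolding subspace_def by (auto simp: rel_derivationD[OF assms(1)])

lemma derivation_corner:
  assumes D: "D \<in> Der" and a: "a \<in> arcs Q"
  shows "e (tail Q a) * D (\<xi> a) * e (head Q a) = D (\<xi> a)"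
proof -
  have zero: "D (e (tail Q a)) = 0" "D (e (head Q a)) = 0"
    using rel_derivationD(4)[OF D] vertex_B tail_in_verts head_in_verts a by auto
  have "D (e (tail Q a) * \<xi> a * e (head Q a)) = e (tail Q a) * D (\<xi> a) * e (head Q a)"
    by (simp add: rel_derivationD(3)[OF D] zero)
  then show ?thesis using tail_arrow arrow_head a by simp
qed

text \<open>A crude bound that presupposes nothing about \<open>D (\<xi> a)\<close>: in the Leibniz
  expansion of \<open>D (\<xi> a * y)\<close> the first term keeps the degree of \<open>y\<close>
  because \<open>R\<close> consists of ideals, and the second regains one degree from
  \<open>\<xi> a\<close>.\<close>

lemma derivation_lowers:
  assumes D: "D \<in> Der"
  shows "y \<in> R (Suc n) \<Longrightarrow> D y \<in> R n"
proof (induction n arbitrary: y)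
  case (Suc n)
  have "D (\<xi> a * y) \<in> R (Suc n)" if "a \<in> arcs Q" "y \<in> R (Suc n)" for a y
    using R_add[OF R_ideal(1)[OF that(2), of "D (\<xi> a)"] R_mult[OF arrow_R[OF that(1)] Suc.IH[OF that(2)], simplified]]
    by (simp add: rel_derivationD(3)[OF D])
  then have "R (Suc (Suc n)) \<subseteq> {y. D y \<in> R (Suc n)}"
    by (intro R_Suc_generated subspace_preimage[OF D] R_subspace) simp
  then show ?case using Suc.prems by blast
qed (simp add: R_0)

text \<open>If \<open>D\<close> sent a loop \<open>a\<close> to \<open>c e\<^sub>i\<close> modulo \<open>R 1\<close> with \<open>c \<noteq> 0\<close>, then applying \<open>D\<close> to \<open>a\<^sup>n \<in> R (n + 1)\<close>,
  with \<open>n\<close> minimal, would give \<open>n c a\<^bsup>n-1\<^esup> \<in> R n\<close>; characteristic zero contradicts minimality.\<close>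

lemma derivation_arrow_R:
  assumes D: "D \<in> Der" and a: "a \<in> arcs Q"
  shows "D (\<xi> a) \<in> R 1"
proof -
  define i where "i = tail Q a"
  define j where "j = head Q a"
  \<comment> \<open>Modulo \<open>R 1\<close> the corner between \<open>e i\<close> and
    \<open>e j\<close> is spanned by \<open>e i\<close> if \<open>i = j\<close> and vanishes
    otherwise; \<open>u\<close> is the spanning element.\<close>
  define u where "u = (if i = j then e i else 0)"
  have ij: "i \<in> verts Q" "j \<in> verts Q"
    using a tail_in_verts head_in_verts by (auto simp: i_def j_def)
  let ?W = "{y. \<exists>c. e i * y * e j - scale c u \<in> R 1}"
  have "?W = UNIV"
  proof (rule generated)
    show "subspace ?W"
      by (rule subspace_corner[OF R_subspace])
    fix v assume v: "v \<in> verts Q"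
    have "e i * e v * e j = scale (if v = i then 1 else 0) u"
      using orth idem v ij by (auto simp: u_def mult.assoc)
    then have "e i * e v * e j - scale (if v = i then 1 else 0) u \<in> R 1"
      using R_0_mem by simp
    then show "e v \<in> ?W" by blast
  next
    fix b y assume "b \<in> arcs Q"
    then have "e i * (\<xi> b * y) * e j \<in> R 1"
      using R_ideal arrow_R by blast
    then have "e i * (\<xi> b * y) * e j - scale 0 u \<in> R 1" by simp
    then show "\<xi> b * y \<in> ?W" by blast
  qed
  then have "D (\<xi> a) \<in> ?W" by simp
  then obtain c where "e i * D (\<xi> a) * e j - scale c u \<in> R 1" by blast
  then have c: "D (\<xi> a) - scale c u \<in> R 1"
    using derivation_corner[OF D a] by (simp add: i_def j_def)
  show ?thesis
  proof (cases "i = j \<and> c \<noteq> 0")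
    case False
    then show ?thesis using c by (auto simp: u_def)
  next
    case True
    define r where "r = D (\<xi> a) - scale c (e i)"
    have r: "r \<in> R 1" "D (\<xi> a) = r + scale c (e i)"
      using c True by (auto simp: u_def r_def)
    \<comment> \<open>The factor \<open>e i\<close> makes the zeroth power the local unit
      \<open>e i\<close> instead of \<open>1\<close>, so that \<open>p n * e i = p n\<close> holds
      for \<open>n = 0\<close> too.\<close>
    define p where "p n = e i * \<xi> a ^ n" for n
    have p_0: "p 0 = e i" and p_Suc: "p (Suc n) = p n * \<xi> a" for n
      by (simp_all add: p_def power_Suc2 mult.assoc del: power_Suc)
    have p_R: "p n \<in> R n" for n
    proof (induction n)
      case (Suc n)
      then show ?case using R_mult[OF Suc arrow_R[OF a]] by (simp add: p_Suc)
    qed (simp add: R_0)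
    have p_e: "p n * e i = p n" for n
      using idem ij arrow_head[OF a] True
      by (cases n) (auto simp: p_0 p_Suc mult.assoc i_def j_def)
    \<comment> \<open>The power rule modulo \<open>R n\<close>. At \<open>n = 0\<close> the
      truncated index \<open>n - 1\<close> is harmless because the coefficient is zero.\<close>
    have D_p: "D (p n) - scale (of_nat n * c) (p (n - 1)) \<in> R n" for n
    proof (induction n)
      case (Suc n)
      define s where "s = D (p n) - scale (of_nat n * c) (p (n - 1))"
      have "scale (of_nat n * c) (p (n - 1)) * \<xi> a = scale (of_nat n * c) (p n)"
        by (cases n) (simp_all add: scale_mult_left p_Suc)
      then have "D (p n) * \<xi> a = s * \<xi> a + scale (of_nat n * c) (p n)"
        by (simp add: s_def algebra_simps)
      then have "D (p (Suc n)) - scale (of_nat (Suc n) * c) (p (Suc n - 1)) = s * \<xi> a + p n * r"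
        by (simp add: p_Suc rel_derivationD(3)[OF D] r(2) distrib_left distrib_right
            mult_scale_right p_e scale_left_distrib)
      moreover have "s * \<xi> a \<in> R (n + 1)" "p n * r \<in> R (n + 1)"
        using R_mult[OF Suc.IH arrow_R[OF a]] R_mult[OF p_R r(1)] by (simp_all add: s_def)
      ultimately show ?case using R_add by simp
    qed (simp add: R_0)
    \<comment> \<open>Each \<open>p n\<close> lies in \<open>R n\<close>; here \<open>n\<close> is
      the first exponent at which it lies one degree deeper. Such an exponent exists because
      \<open>p N\<close> is in \<open>R N\<close>, which is zero.\<close>
    define n where "n = (LEAST n. p n \<in> R (Suc n))"
    have "p N \<in> R (Suc N)" using p_R[of N] R_nilpotent R_0_mem by auto
    then have n: "p n \<in> R (Suc n)" unfolding n_def by (rule LeastI)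
    have "n \<noteq> 0"
    proof
      assume "n = 0"
      then show False using n vertex_not_R[OF ij(1)] p_0 by simp
    qed
    then obtain m where m: "n = Suc m" using not0_implies_Suc by blast
    have "D (p n) \<in> R n" using derivation_lowers[OF D n] .
    from R_diff[OF this D_p[of n]] have "scale (of_nat n * c) (p m) \<in> R (Suc m)"
      by (simp add: m)
    from R_scale[OF this, of "inverse (of_nat n * c)"]
    have "scale (inverse (of_nat n * c) * (of_nat n * c)) (p m) \<in> R (Suc m)"
      by (simp only: scale_scale)
    moreover have "inverse (of_nat n * c) * (of_nat n * c) = 1"
      using True \<open>n \<noteq> 0\<close> by (intro left_inverse) simp
    ultimately have "p m \<in> R (Suc m)" by (simp only: scale_one)
    then have "n \<le> m" unfolding n_def by (rule Least_le)
    then show ?thesis using m by simp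
  qed
qed

text \<open>The Leibniz rule replaces one arrow, of degree 1, by an element of degree
  \<open>k + 1\<close>, a gain of \<open>k\<close>. For \<open>k = 0\<close> this says that the
  filtration is preserved.\<close>

lemma derivation_raises:
  assumes D: "D \<in> Der" and arr: "\<And>a. a \<in> arcs Q \<Longrightarrow> D (\<xi> a) \<in> R (Suc k)"
  shows "y \<in> R n \<Longrightarrow> D y \<in> R (n + k)"
proof (induction n arbitrary: y)
  case 0
  \<comment> \<open>\<open>R_Suc_generated\<close> starts at degree 1, so degree 0 is handled
    through \<open>generated\<close>: vertices are killed, and the values on arrows are used only as
    elements of \<open>R k\<close>.\<close>
  have "{y. D y \<in> R k} = UNIV"
  proof (rule generated[OF subspace_preimage[OF D R_subspace]])
    show "e v \<in> {y. D y \<in> R k}" if "v \<in> verts Q" for v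
      using rel_derivationD(4)[OF D vertex_B[OF that]] R_0_mem by simp
    fix a y assume a: "a \<in> arcs Q" and "y \<in> {y. D y \<in> R k}"
    moreover have "D (\<xi> a) \<in> R k" using arr[OF a] R_antimono[of k "Suc k"] by auto
    ultimately show "\<xi> a * y \<in> {y. D y \<in> R k}"
      by (simp add: rel_derivationD(3)[OF D] R_ideal R_add)
  qed
  then show ?case by auto
next
  case (Suc n)
  have "D (\<xi> a * y) \<in> R (Suc n + k)" if "a \<in> arcs Q" "y \<in> R n" for a y
    using R_add[OF R_mult[OF arr[OF that(1)] that(2)], of "\<xi> a * D y"]
      R_mult[OF arrow_R[OF that(1)] Suc.IH[OF that(2)]]
    by (simp add: rel_derivationD(3)[OF D] add.commute)
  then have "R (Suc n) \<subseteq> {y. D y \<in> R (Suc n + k)}"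
    by (intro R_Suc_generated subspace_preimage[OF D] R_subspace) simp
  then show ?case using Suc.prems by blast
qed

lemma derivation_V:
  assumes D: "D \<in> Der" and "y \<in> V"
  shows "D y \<in> R 2"
proof -
  obtain b r where "y = b + r" "b \<in> B" "r \<in> R 2" using assms(2) by (auto simp: V_def)
  moreover have "D r \<in> R (2 + 0)" if "r \<in> R 2" for r
    using derivation_raises[OF D _ that, of 0] derivation_arrow_R[OF D] by simp
  ultimately show ?thesis by (simp add: rel_derivationD[OF D])
qed

text \<open>Modulo \<open>R 2\<close>, the corner of \<open>R 1\<close> containing
  \<open>D (\<xi> a)\<close> is spanned by the arrows parallel to \<open>a\<close> and
  \<open>a\<close> itself. Those in \<open>S\<close> vanish modulo \<open>V\<close>, and
  \<open>a\<close> is the only one outside \<open>S\<close>.\<close>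

lemma derivation_arrow_eigen:
  assumes D: "D \<in> Der" and a: "a \<in> arcs Q - S"
  shows "\<exists>c. D (\<xi> a) - scale c (\<xi> a) \<in> V"
proof -
  define i where "i = tail Q a"
  define j where "j = head Q a"
  have ij: "i \<in> verts Q" "j \<in> verts Q"
    using a tail_in_verts head_in_verts by (auto simp: i_def j_def)
  let ?W = "{y. \<exists>c. e i * y * e j - scale c (\<xi> a) \<in> V}"
  have W: "subspace ?W"
    by (rule subspace_corner[OF V_subspace])
  have "\<xi> b * y \<in> ?W" if b: "b \<in> arcs Q" for b y
  proof -
    \<comment> \<open>A second generation argument, in the right factor: for a vertex the product is
      \<open>\<xi> b\<close> or zero, and for \<open>\<xi> d * y\<close> it already lies in
      \<open>R 2\<close>.\<close>
    have "{y. \<xi> b * y \<in> ?W} = UNIV"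
    proof (rule generated)
      show "subspace {y. \<xi> b * y \<in> ?W}"
        using W unfolding subspace_def by (simp only: mem_Collect_eq distrib_left mult_scale_right mult_zero_right) blast
      fix v assume v: "v \<in> verts Q"
      have left: "e i * e (tail Q b) = (if i = tail Q b then e i else 0)"
        using idem[OF ij(1)] orth[OF ij(1) tail_in_verts[OF b]] by (cases "i = tail Q b") simp_all
      have right: "e (head Q b) * e v * e j = (if j = head Q b \<and> v = j then e j else 0)"
      proof (cases "v = head Q b")
        case True
        then show ?thesis
          using idem[OF v] orth[OF v ij(2)] by (cases "v = j") simp_all
      next
        case False
        then show ?thesis using orth[OF head_in_verts[OF b] v] by (cases "v = j") simp_all
      qed
      have "e i * (\<xi> b * e v) * e j = e i * (e (tail Q b) * \<xi> b * e (head Q b) * e v) * e j"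
        by (simp only: tail_arrow[OF b] arrow_head[OF b])
      also have "\<dots> = e i * e (tail Q b) * \<xi> b * (e (head Q b) * e v * e j)"
        by (simp only: mult.assoc)
      finally have eq: "e i * (\<xi> b * e v) * e j =
          (if i = tail Q b \<and> j = head Q b \<and> v = j then \<xi> b else 0)"
        unfolding left right by (simp add: tail_arrow[OF b] arrow_head[OF b] split: if_splits)
      show "e v \<in> {y. \<xi> b * y \<in> ?W}"
      \<comment> \<open>A surviving arrow outside \<open>S\<close> must be \<open>a\<close>, with
        coefficient 1. In all other cases the corner is zero or an arrow in \<open>B\<close>, and
        coefficient 0 works.\<close>
      proof (cases "i = tail Q b \<and> j = head Q b \<and> v = j \<and> b \<notin> S")
        case True
        then have "b = a" using not_parallel a b by (auto simp: i_def j_def)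
        then have "e i * (\<xi> b * e v) * e j - scale 1 (\<xi> a) = 0"
          using True eq by simp
        then show ?thesis using subspace_0[OF V_subspace] by (auto intro: exI[of _ 1])
      next
        case False
        then have "e i * (\<xi> b * e v) * e j \<in> V"
          using eq B_V arrow_B subspace_0[OF V_subspace] by auto
        then show ?thesis by (auto intro: exI[of _ 0])
      qed
    next
      fix d y assume d: "d \<in> arcs Q"
      have "\<xi> b * \<xi> d \<in> R 2" using R_mult[OF arrow_R[OF b] arrow_R[OF d]]
        by (simp add: numeral_2_eq_2)
      then have "\<xi> b * (\<xi> d * y) \<in> R 2"
        unfolding mult.assoc[symmetric] by (rule R_ideal(2))
      then have "e i * (\<xi> b * (\<xi> d * y)) * e j \<in> V"
        using R_ideal R_V by blast
      then have "e i * (\<xi> b * (\<xi> d * y)) * e j - scale 0 (\<xi> a) \<in> V" by simp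
      then show "\<xi> d * y \<in> {y. \<xi> b * y \<in> ?W}" by blast
    qed
    then show ?thesis by blast
  qed
  then have "R (Suc 0) \<subseteq> ?W" using R_Suc_generated[OF W] by blast
  moreover have "D (\<xi> a) \<in> R (Suc 0)" using derivation_arrow_R[OF D] a by simp
  ultimately obtain c where "e i * D (\<xi> a) * e j - scale c (\<xi> a) \<in> V" by blast
  then have "D (\<xi> a) - scale c (\<xi> a) \<in> V"
    using derivation_corner[OF D, of a] a by (simp add: i_def j_def)
  then show ?thesis ..
qed

text \<open>Stage 1 is exceptional because eigenvalues on arrows cancel only modulo
  \<open>V\<close>; arrows in \<open>S\<close> need no condition there, being killed. From stage 2
  on, \<open>chain n\<close> consists of derivations raising the degree by
  \<open>n - 1\<close>.\<close>

fun chain :: "nat \<Rightarrow> ('a \<Rightarrow> 'a) set" where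
  "chain 0 = Der"
| "chain (Suc 0) = {D \<in> Der. \<forall>a\<in>arcs Q - S. D (\<xi> a) \<in> V}"
| "chain (Suc (Suc n)) = {D \<in> Der. \<forall>a\<in>arcs Q. D (\<xi> a) \<in> R (Suc (Suc n))}"

lemma rel_HH1_solvable: "solvable_lie_algebra (rel_HH1 scale B)"
proof -
  let ?L = "rel_derivation_lie scale B"
  interpret L: lie_algebra ?L by (rule lie_algebra_rel_derivations)
  have ops: "lcarrier ?L = Der" "lzero ?L = (\<lambda>x. 0)" "ladd ?L D F = (\<lambda>x. D x + F x)"
    "lscale ?L c D = (\<lambda>x. scale c (D x))" "lbracket ?L D F = (\<lambda>x. D (F x) - F (D x))" for c D F
    by (simp_all add: rel_derivation_lie_def)
  have chain_subspace: "lie_subspace ?L {D \<in> Der. \<forall>a\<in>X. D (\<xi> a) \<in> W}" if "subspace W" for X W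
    using L.zero_closed L.add_closed L.scale_closed that
    unfolding lie_subspace_def subspace_def ops by simp
  have chain_Der: "chain n \<subseteq> Der" for n by (cases n rule: chain.cases) auto
  show ?thesis unfolding rel_HH1_def
  proof (rule L.lie_quotient_solvable_by_chain[OF lie_ideal_rel_inner_derivations])
    show "chain 0 = lcarrier ?L" by (simp add: ops)
    \<comment> \<open>\<open>chain 0\<close> is the instance with no arrows to constrain; the later
      stages constrain them by \<open>V\<close> or by a layer of \<open>R\<close>.\<close>
    show "lie_subspace ?L (chain n)" for n
      using chain_subspace[OF V_subspace] chain_subspace[OF R_subspace]
        chain_subspace[of UNIV "{}"] subspace_UNIV
      by (cases n rule: chain.cases) auto
    show "lbracket ?L D F \<in> chain (Suc n)" if DF: "D \<in> chain n" "F \<in> chain n" for n D F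
    proof -
      have D: "D \<in> Der" and F: "F \<in> Der" using DF chain_Der by auto
      note der = rel_derivationD[OF D] rel_derivationD[OF F]
      have br: "lbracket ?L D F \<in> Der" using L.bracket_closed[of D F] D F by (simp add: ops)
      show ?thesis
      proof (cases n rule: chain.cases)
        case 1
        have "D (F (\<xi> a)) - F (D (\<xi> a)) \<in> V" if a: "a \<in> arcs Q - S" for a
        proof -
          obtain c d where cd: "D (\<xi> a) - scale c (\<xi> a) \<in> V" "F (\<xi> a) - scale d (\<xi> a) \<in> V"
            using derivation_arrow_eigen[OF D a] derivation_arrow_eigen[OF F a] by blast
          define s t where "s = D (\<xi> a) - scale c (\<xi> a)" and "t = F (\<xi> a) - scale d (\<xi> a)"
          have st: "D (\<xi> a) = scale c (\<xi> a) + s" "F (\<xi> a) = scale d (\<xi> a) + t" "s \<in> V" "t \<in> V"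
            using cd by (simp_all add: s_def t_def)
          \<comment> \<open>Modulo \<open>V\<close> both derivations act on \<open>\<xi> a\<close>
            by scalars, which commute: the two terms with coefficient \<open>c * d\<close>
            cancel.\<close>
          have "D (F (\<xi> a)) - F (D (\<xi> a)) = (scale d s - scale c t) + (D t - F s)"
            unfolding st(1,2) by (simp add: der st(1,2) scale_right_distrib mult.commute)
          moreover have "D t - F s \<in> V"
            using derivation_V[OF D] derivation_V[OF F] st R_diff R_V by blast
          moreover have "scale d s - scale c t \<in> V"
            using st subspace_diff[OF V_subspace] subspace_scale[OF V_subspace] by blast
          ultimately show ?thesis using subspace_add[OF V_subspace] by simp
        qed
        then show ?thesis using br 1 by (simp add: ops)
      next
        case 2
        have "D (F (\<xi> a)) - F (D (\<xi> a)) \<in> R 2" if a: "a \<in> arcs Q" for a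
        proof (cases "a \<in> S")
          case True
          then show ?thesis using arrow_B R_0_mem by (simp add: der)
        next
          case False
          then have "D (\<xi> a) \<in> V" "F (\<xi> a) \<in> V" using DF 2 a by auto
          then show ?thesis using derivation_V[OF D] derivation_V[OF F] R_diff by blast
        qed
        then show ?thesis using br 2 by (simp add: ops numeral_2_eq_2)
      next
        case (3 k)
        have arr: "\<And>a. a \<in> arcs Q \<Longrightarrow> D (\<xi> a) \<in> R (Suc (Suc k))"
          "\<And>a. a \<in> arcs Q \<Longrightarrow> F (\<xi> a) \<in> R (Suc (Suc k))" using DF 3 by auto
        have "D (F (\<xi> a)) - F (D (\<xi> a)) \<in> R (Suc (Suc (Suc k)))" if a: "a \<in> arcs Q" for a
        proof -
          \<comment> \<open>Each derivation raises the degree by \<open>k + 1\<close>, and is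
            applied to the other's value of degree \<open>k + 2\<close>. Only one degree of this
            gain is kept.\<close>
          have "D (F (\<xi> a)) - F (D (\<xi> a)) \<in> R (Suc (Suc k) + Suc k)"
            by (intro R_diff derivation_raises D F arr a)
          then show ?thesis using R_antimono[of "Suc (Suc (Suc k))" "Suc (Suc k) + Suc k"] by auto
        qed
        then show ?thesis using br 3 by (simp add: ops)
      qed
    qed
    show "chain (Suc (Suc N)) = {lzero ?L}"
    proof -
      have "D = (\<lambda>x. 0)" if "D \<in> chain (Suc (Suc N))" for D
      proof
        fix y
        \<comment> \<open>Arrows go to degree \<open>N + 2\<close>, so \<open>D\<close> raises the
          degree by \<open>N + 1\<close>, which already annihilates degree 0, that is, the whole
          algebra.\<close>
        have "D y \<in> R (0 + Suc N)"
          by (rule derivation_raises) (use that R_0 in auto)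
        then show "D y = 0" using R_antimono[of N "Suc N"] R_nilpotent by auto
      qed
      moreover have "(\<lambda>x. 0) \<in> chain (Suc (Suc N))"
        using L.zero_closed R_0_mem by (simp add: ops)
      ultimately show ?thesis by (auto simp: ops)
    qed
  qed
qed

end

section \<open>The filtration of an algebra presented by a quiver\<close>

lemma lookup_path_scale: "Poly_Mapping.lookup (path_scale c f) p = c * Poly_Mapping.lookup f p"
  by (simp add: path_scale_def Poly_Mapping.map.rep_eq when_def)

lemma path_scale_single: "path_scale c (Poly_Mapping.single p d) = Poly_Mapping.single p (c * d)"
  by (simp add: path_scale_def)

lemma path_scale_sum_single:
  "f = (\<Sum>p\<in>Poly_Mapping.keys f. path_scale (Poly_Mapping.lookup f p) (Poly_Mapping.single p 1))"
proof (rule poly_mapping_eqI)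
  fix q
  have "(\<Sum>p\<in>Poly_Mapping.keys f. Poly_Mapping.lookup f p when p = q) = Poly_Mapping.lookup f q"
    by (cases "q \<in> Poly_Mapping.keys f") (auto simp: when_def in_keys_iff)
  then show "Poly_Mapping.lookup f q = Poly_Mapping.lookup
      (\<Sum>p\<in>Poly_Mapping.keys f. path_scale (Poly_Mapping.lookup f p) (Poly_Mapping.single p 1)) q"
    by (simp add: lookup_sum path_scale_single lookup_single)
qed

lemma arrow_ideal_power_0: "arrow_ideal_power Q 0 = path_algebra Q"
  by (simp add: arrow_ideal_power_def)

lemma arrow_ideal_power_antimono: "m \<le> n \<Longrightarrow> arrow_ideal_power Q n \<subseteq> arrow_ideal_power Q m"
  by (auto simp: arrow_ideal_power_def)

lemma zero_in_arrow_ideal_power: "0 \<in> arrow_ideal_power Q n"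
  by (simp add: arrow_ideal_power_def path_algebra_def)

lemma add_in_arrow_ideal_power:
  assumes "f \<in> arrow_ideal_power Q n" "g \<in> arrow_ideal_power Q n"
  shows "f + g \<in> arrow_ideal_power Q n"
  using assms keys_add[of f g] unfolding arrow_ideal_power_def path_algebra_def by blast

lemma sum_in_arrow_ideal_power:
  "(\<And>i. i \<in> I \<Longrightarrow> f i \<in> arrow_ideal_power Q n) \<Longrightarrow> sum f I \<in> arrow_ideal_power Q n"
  by (induction I rule: infinite_finite_induct)
     (simp_all add: zero_in_arrow_ideal_power add_in_arrow_ideal_power)

lemma path_scale_in_arrow_ideal_power:
  assumes "f \<in> arrow_ideal_power Q n"
  shows "path_scale c f \<in> arrow_ideal_power Q n"
proof -
  have "Poly_Mapping.keys (path_scale c f) \<subseteq> Poly_Mapping.keys f"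
    by (auto simp: in_keys_iff lookup_path_scale)
  then show ?thesis using assms unfolding arrow_ideal_power_def path_algebra_def by blast
qed

lemma single_in_arrow_ideal_power:
  "p \<in> quiver_paths Q \<Longrightarrow> n \<le> length (snd p) \<Longrightarrow> Poly_Mapping.single p c \<in> arrow_ideal_power Q n"
  by (simp add: arrow_ideal_power_def path_algebra_def)

lemma path_mult_single:
  "path_mult Q (Poly_Mapping.single (u, p) 1) (Poly_Mapping.single (v, q) 1) =
    (if pre_digraph.awlast Q u p = v then Poly_Mapping.single (u, p @ q) 1 else 0)"
  by (simp add: path_mult_def)

context wf_digraph
begin

text \<open>Lengths add under concatenation, and the test on \<open>awlast\<close> in
  \<open>path_mult\<close> ensures that the concatenation is again a walk.\<close>

lemma path_mult_in_arrow_ideal_power: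
  assumes f: "f \<in> arrow_ideal_power G m" and g: "g \<in> arrow_ideal_power G n"
  shows "path_mult G f g \<in> arrow_ideal_power G (m + n)"
  unfolding path_mult_def
proof (intro sum_in_arrow_ideal_power)
  fix p q assume p: "p \<in> Poly_Mapping.keys f" and q: "q \<in> Poly_Mapping.keys g"
  have "(fst p, snd p @ snd q) \<in> quiver_paths G" if "awlast (fst p) (snd p) = fst q"
  proof -
    obtain v where v: "awalk (fst p) (snd p) v"
      using f p by (auto simp: arrow_ideal_power_def path_algebra_def quiver_paths_def)
    obtain w where w: "awalk (fst q) (snd q) w"
      using g q by (auto simp: arrow_ideal_power_def path_algebra_def quiver_paths_def)
    have "v = fst q" using v that by auto
    then show ?thesis using v w awalk_appendI by (auto simp: quiver_paths_def)
  qed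
  moreover have "m \<le> length (snd p)" "n \<le> length (snd q)"
    using f g p q by (auto simp: arrow_ideal_power_def)
  ultimately show "(if awlast (fst p) (snd p) = fst q
      then Poly_Mapping.single (fst p, snd p @ snd q)
        (Poly_Mapping.lookup f p * Poly_Mapping.lookup g q) else 0) \<in> arrow_ideal_power G (m + n)"
    by (simp add: single_in_arrow_ideal_power zero_in_arrow_ideal_power)
qed

lemma arrow_path: "a \<in> arcs G \<Longrightarrow> (tail G a, [a]) \<in> quiver_paths G"
  by (auto simp: quiver_paths_def awalk_Cons_iff awalk_Nil_iff)

lemma vertex_path: "v \<in> verts G \<Longrightarrow> (v, []) \<in> quiver_paths G"
  by (auto simp: quiver_paths_def awalk_Nil_iff)

lemma path_Cons_iff:
  "(u, a # p) \<in> quiver_paths G \<longleftrightarrow> a \<in> arcs G \<and> u = tail G a \<and> (head G a, p) \<in> quiver_paths G"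
  by (auto simp: quiver_paths_def awalk_Cons_iff)

end

locale quiver_presentation = assoc_algebra scale + wf_digraph Q
  for scale :: "'k::field \<Rightarrow> 'a::ring_1 \<Rightarrow> 'a" and Q :: "('v, 'e) pre_digraph" +
  fixes e :: "'v \<Rightarrow> 'a" and \<nu> :: "('v \<times> 'e list \<Rightarrow>\<^sub>0 'k) \<Rightarrow> 'a"
  assumes presentation: "admissible_presentation scale UNIV Q e \<nu>"
begin

section \<open>Arrows and filtration in the presented algebra\<close>

abbreviation path :: "'v \<times> 'e list \<Rightarrow> ('v \<times> 'e list \<Rightarrow>\<^sub>0 'k)" where
  "path p \<equiv> Poly_Mapping.single p 1"

definition arrow :: "'e \<Rightarrow> 'a" where "arrow a = \<nu> (path (tail Q a, [a]))"

definition R :: "nat \<Rightarrow> 'a set" where "R n = \<nu> ` arrow_ideal_power Q n"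

lemma nu_add: "f \<in> path_algebra Q \<Longrightarrow> g \<in> path_algebra Q \<Longrightarrow> \<nu> (f + g) = \<nu> f + \<nu> g"
  and nu_scale: "f \<in> path_algebra Q \<Longrightarrow> \<nu> (path_scale c f) = scale c (\<nu> f)"
  and nu_mult: "f \<in> path_algebra Q \<Longrightarrow> g \<in> path_algebra Q \<Longrightarrow> \<nu> (path_mult Q f g) = \<nu> f * \<nu> g"
  and nu_vertex: "v \<in> verts Q \<Longrightarrow> \<nu> (path (v, [])) = e v"
  and nu_surj: "\<nu> ` path_algebra Q = UNIV"
  using presentation by (simp_all add: admissible_presentation_def path_algebra_hom_def)

lemma path_mem: "p \<in> quiver_paths Q \<Longrightarrow> path p \<in> path_algebra Q"
  using single_in_arrow_ideal_power[of p Q 0] by (simp add: arrow_ideal_power_0)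

lemma power_mem: "f \<in> arrow_ideal_power Q n \<Longrightarrow> f \<in> path_algebra Q"
  by (simp add: arrow_ideal_power_def)

lemma nu_zero: "\<nu> 0 = 0"
  using nu_add[of 0 0] by (simp add: path_algebra_def)

text \<open>The first arrow is split off, to match the left multiplications in
  \<open>generated\<close> and \<open>R_Suc_generated\<close>.\<close>

lemma nu_path_Cons:
  assumes "(u, a # p) \<in> quiver_paths Q"
  shows "\<nu> (path (u, a # p)) = arrow a * \<nu> (path (head Q a, p))"
proof -
  have a: "a \<in> arcs Q" "u = tail Q a" "(head Q a, p) \<in> quiver_paths Q"
    using assms by (auto simp: path_Cons_iff)
  have "path (u, a # p) = path_mult Q (path (tail Q a, [a])) (path (head Q a, p))"
    by (simp add: path_mult_single a(2))
  then show ?thesis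
    using nu_mult[OF path_mem[OF arrow_path[OF a(1)]] path_mem[OF a(3)]] by (simp add: arrow_def)
qed

lemma R_subspace: "subspace (R n)"
proof (rule subspaceI)
  show "0 \<in> R n" unfolding R_def using zero_in_arrow_ideal_power nu_zero by (metis imageI)
  show "x + y \<in> R n" if "x \<in> R n" "y \<in> R n" for x y
    using that add_in_arrow_ideal_power unfolding R_def
    by (smt (verit) imageE imageI nu_add power_mem)
  show "scale c x \<in> R n" if "x \<in> R n" for c x
    using that path_scale_in_arrow_ideal_power unfolding R_def
    by (smt (verit) imageE imageI nu_scale power_mem)
qed

lemma R_0: "R 0 = UNIV"
  by (simp add: R_def arrow_ideal_power_0 nu_surj)

lemma R_antimono: "m \<le> n \<Longrightarrow> R n \<subseteq> R m"
  unfolding R_def by (intro image_mono arrow_ideal_power_antimono)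

lemma R_mult:
  assumes "y \<in> R m" "z \<in> R n"
  shows "y * z \<in> R (m + n)"
proof -
  obtain f g where "f \<in> arrow_ideal_power Q m" "g \<in> arrow_ideal_power Q n" "y = \<nu> f" "z = \<nu> g"
    using assms by (auto simp: R_def)
  moreover from this have "y * z = \<nu> (path_mult Q f g)" by (simp add: nu_mult power_mem)
  ultimately show ?thesis using path_mult_in_arrow_ideal_power unfolding R_def by blast
qed

lemma path_R: "p \<in> quiver_paths Q \<Longrightarrow> n \<le> length (snd p) \<Longrightarrow> \<nu> (path p) \<in> R n"
  unfolding R_def by (intro imageI single_in_arrow_ideal_power)

lemma arrow_R: "a \<in> arcs Q \<Longrightarrow> arrow a \<in> R 1"
  unfolding arrow_def by (rule path_R) (simp_all add: arrow_path)

text \<open>\<open>R n\<close> is spanned by the images of long paths. As \<open>\<nu>\<close> is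
  linear only on \<open>path_algebra Q\<close>, the sum over the support is treated by finite
  induction, with membership checked for every partial sum.\<close>

lemma R_subset:
  assumes W: "subspace W"
    and paths: "\<And>p. p \<in> quiver_paths Q \<Longrightarrow> n \<le> length (snd p) \<Longrightarrow> \<nu> (path p) \<in> W"
  shows "R n \<subseteq> W"
proof
  fix y assume "y \<in> R n"
  then obtain f where f: "f \<in> arrow_ideal_power Q n" "y = \<nu> f" by (auto simp: R_def)
  let ?t = "\<lambda>p. path_scale (Poly_Mapping.lookup f p) (path p)"
  have "\<nu> (sum ?t P) \<in> W" if "finite P" "P \<subseteq> Poly_Mapping.keys f" for P
    using that
  proof (induction P)
    case (insert p P)
    have p: "p \<in> quiver_paths Q" "n \<le> length (snd p)"
      using f insert.prems by (auto simp: arrow_ideal_power_def path_algebra_def)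
    have mem: "?t q \<in> path_algebra Q" if "q \<in> insert p P" for q
    proof -
      have "q \<in> quiver_paths Q"
        using f(1) insert.prems that by (auto simp: arrow_ideal_power_def path_algebra_def)
      then show ?thesis
        using path_scale_in_arrow_ideal_power[of "path q" Q 0] path_mem
        by (simp add: arrow_ideal_power_0)
    qed
    have "sum ?t P \<in> path_algebra Q"
      using sum_in_arrow_ideal_power[of P ?t Q 0] mem by (simp add: arrow_ideal_power_0)
    then have "\<nu> (sum ?t (insert p P)) = scale (Poly_Mapping.lookup f p) (\<nu> (path p)) + \<nu> (sum ?t P)"
      using insert.hyps mem[of p] by (simp add: nu_add nu_scale path_mem p)
    then show ?case
      using insert paths[OF p] by (simp add: subspace_add[OF W] subspace_scale[OF W])
  qed (simp add: nu_zero subspace_0[OF W])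
  from this[of "Poly_Mapping.keys f"] show "y \<in> W"
    using path_scale_sum_single[of f] f(2) by simp
qed

text \<open>Induction on paths: a stationary path gives a vertex, and any other path is an arrow
  times a shorter path.\<close>

lemma generated:
  assumes W: "subspace W" and vert: "\<And>v. v \<in> verts Q \<Longrightarrow> e v \<in> W"
    and arr: "\<And>a y. a \<in> arcs Q \<Longrightarrow> y \<in> W \<Longrightarrow> arrow a * y \<in> W"
  shows "W = UNIV"
proof -
  have "\<nu> (path (u, p)) \<in> W" if "(u, p) \<in> quiver_paths Q" for u p
    using that
  proof (induction p arbitrary: u)
    case Nil
    then have "u \<in> verts Q" by (auto simp: quiver_paths_def)
    then show ?case using vert nu_vertex by simp
  next
    case (Cons a p)
    then show ?case using arr nu_path_Cons[OF Cons.prems] by (simp add: path_Cons_iff)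
  qed
  then have "R 0 \<subseteq> W" by (intro R_subset[OF W]) (metis surj_pair)
  then show ?thesis using R_0 by blast
qed

lemma R_Suc_generated:
  assumes W: "subspace W" and arr: "\<And>a y. a \<in> arcs Q \<Longrightarrow> y \<in> R n \<Longrightarrow> arrow a * y \<in> W"
  shows "R (Suc n) \<subseteq> W"
proof (rule R_subset[OF W])
  fix p assume p: "p \<in> quiver_paths Q" "Suc n \<le> length (snd p)"
  then obtain u a q where q: "p = (u, a # q)" by (cases p) (auto simp: Suc_le_length_iff)
  then show "\<nu> (path p) \<in> W"
    using p arr path_R[of "(head Q a, q)" n] nu_path_Cons[of u a q] by (simp add: path_Cons_iff)
qed

lemma R_nilpotent: "\<exists>N. R N = {0}"
proof -
  obtain m where "arrow_ideal_power Q m \<subseteq> {f \<in> path_algebra Q. \<nu> f = 0}"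
    using presentation by (auto simp: admissible_presentation_def admissible_def)
  then have "R m \<subseteq> {0}" by (auto simp: R_def)
  moreover have "0 \<in> R m" by (rule subspace_0[OF R_subspace])
  ultimately show ?thesis by blast
qed

text \<open>If \<open>e v = \<nu> f\<close> with \<open>f\<close> in the arrow ideal, then the
  stationary path minus \<open>f\<close> lies in the kernel and has coefficient 1 at a path of
  length 0. Admissibility allows only paths of length at least 2.\<close>

lemma vertex_not_R:
  assumes v: "v \<in> verts Q"
  shows "e v \<notin> R 1"
proof
  assume "e v \<in> R 1"
  then obtain f where f: "f \<in> arrow_ideal_power Q 1" "e v = \<nu> f" by (auto simp: R_def)
  define g where "g = path (v, []) + path_scale (- 1) f"
  have fm: "f \<in> path_algebra Q" "path_scale (- 1) f \<in> path_algebra Q"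
    using power_mem path_scale_in_arrow_ideal_power f(1) by blast+
  have vm: "path (v, []) \<in> path_algebra Q" using path_mem vertex_path v by blast
  have "\<nu> g = 0" using fm vm by (simp add: g_def nu_add nu_scale nu_vertex v f(2))
  moreover have "g \<in> path_algebra Q"
    using add_in_arrow_ideal_power[of _ Q 0] fm vm by (simp add: g_def arrow_ideal_power_0)
  moreover have "{f \<in> path_algebra Q. \<nu> f = 0} \<subseteq> arrow_ideal_power Q 2"
    using presentation by (auto simp: admissible_presentation_def admissible_def)
  ultimately have "g \<in> arrow_ideal_power Q 2" by blast
  then have "(v, []) \<notin> Poly_Mapping.keys g" by (auto simp: arrow_ideal_power_def)
  moreover have "(v, []) \<notin> Poly_Mapping.keys f" using f(1) by (auto simp: arrow_ideal_power_def)
  ultimately show False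
    by (simp add: in_keys_iff g_def lookup_add lookup_path_scale)
qed

lemma tail_arrow:
  assumes a: "a \<in> arcs Q"
  shows "e (tail Q a) * arrow a = arrow a"
proof -
  have "path_mult Q (path (tail Q a, [])) (path (tail Q a, [a])) = path (tail Q a, [a])"
    by (simp add: path_mult_single)
  then show ?thesis
    using nu_mult[OF path_mem[OF vertex_path] path_mem[OF arrow_path], of "tail Q a" a] a
    by (simp add: arrow_def nu_vertex)
qed

lemma arrow_head:
  assumes a: "a \<in> arcs Q"
  shows "arrow a * e (head Q a) = arrow a"
  using nu_path_Cons[of "tail Q a" a "[]"] arrow_path[OF a] a
  by (simp add: arrow_def nu_vertex)

end

section \<open>Solvability\<close>

theorem theorem1:
  fixes scale :: "'k::{alg_closed_field, field_char_0} \<Rightarrow> 'a::ring_1 \<Rightarrow> 'a"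
    and B :: "'a set"
    and QA QB :: "('v, 'e) pre_digraph"
    and e :: "'v \<Rightarrow> 'a"
    and \<nu>A \<nu>B :: "('v \<times> 'e list \<Rightarrow>\<^sub>0 'k) \<Rightarrow> 'a"
  assumes algebra: "assoc_algebra scale"
    and findim: "finite_dimensional scale"
    and basic_A: "basic_algebra (UNIV :: 'a set)"
    and quiver_A: "gabriel_quiver scale UNIV QA e"
    and subalg: "subalgebra scale B"
    and basic_B: "basic_algebra B"
    and quiver_B: "gabriel_quiver scale B QB e"
    and subquiver: "spanning QB QA"
    and pres_A: "admissible_presentation scale UNIV QA e \<nu>A"
    and pres_B: "admissible_presentation scale B QB e \<nu>B"
    and pres_compat: "\<And>f. f \<in> path_algebra QB \<Longrightarrow> \<nu>A f = \<nu>B f"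
    and semisimple: "\<exists>E. semisimple_part scale UNIV E \<and> semisimple_part scale B E"
    and no_parallel: "\<And>a b. a \<in> arcs (complement_quiver QA QB) \<Longrightarrow>
      b \<in> arcs (complement_quiver QA QB) \<Longrightarrow> \<not> parallel_arrows (complement_quiver QA QB) a b"
    and one_loop: "\<And>v. v \<in> verts (complement_quiver QA QB) \<Longrightarrow>
      card (arrows_between (complement_quiver QA QB) v v) \<le> 1"
  shows "solvable_lie_algebra (rel_HH1 scale B)"
proof -
  interpret A: assoc_algebra scale by (rule algebra)
  have verts: "verts QB = verts QA" and ends: "tail QB = tail QA" "head QB = head QA"
    and wf: "wf_digraph QA" "wf_digraph QB"
    using subquiver by (auto simp: spanning_def subgraph_def compatible_def)
  interpret P: quiver_presentation scale QA e \<nu>A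
    by (intro quiver_presentation.intro quiver_presentation_axioms.intro algebra wf pres_A)
  interpret QB: wf_digraph QB by (rule wf)
  have idems: "complete_primitive_orthogonal_idempotents UNIV (verts QA) e"
    using quiver_A by (simp add: gabriel_quiver_def)
  \<comment> \<open>The compatibility of the two presentations enters here: it places the vertices
    and the arrows of \<open>QB\<close>, computed with \<open>\<nu>A\<close>, inside
    \<open>B\<close>.\<close>
  have path_B: "\<nu>A (Poly_Mapping.single p 1) \<in> B" if "p \<in> quiver_paths QB" for p
  proof -
    have p: "Poly_Mapping.single p 1 \<in> path_algebra QB" using that by (simp add: path_algebra_def)
    moreover have "\<nu>B ` path_algebra QB = B"
      using pres_B by (simp add: admissible_presentation_def)
    ultimately show ?thesis using pres_compat[OF p] by blast
  qed
  obtain N where N: "P.R N = {0}" using P.R_nilpotent by blast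
  interpret F: arrow_filtration scale QA e P.arrow P.R N B "arcs QB"
  proof
    show "e v * e v = e v" if "v \<in> verts QA" for v
      using idems that
      by (simp add: complete_primitive_orthogonal_idempotents_def primitive_idempotent_def)
    show "e v * e w = 0" if "v \<in> verts QA" "w \<in> verts QA" "v \<noteq> w" for v w
      using idems that by (simp add: complete_primitive_orthogonal_idempotents_def)
    show "A.subspace B" using subalg by (simp add: subalgebra_def)
    show "e v \<in> B" if "v \<in> verts QA" for v
      using path_B[OF QB.vertex_path] that P.nu_vertex verts by simp
    show "P.arrow a \<in> B" if "a \<in> arcs QB" for a
      using path_B[OF QB.arrow_path[OF that]] by (simp add: P.arrow_def ends)
    show "a = b" if "a \<in> arcs QA - arcs QB" "b \<in> arcs QA - arcs QB"
      "tail QA a = tail QA b" "head QA a = head QA b" for a b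
      using no_parallel[of a b] that by (simp add: complement_quiver_def parallel_arrows_def)
  qed (fact P.tail_arrow P.arrow_head P.arrow_R P.R_subspace P.R_mult P.R_0 P.R_antimono N
      P.vertex_not_R P.generated P.R_Suc_generated)+
  show ?thesis by (rule F.rel_HH1_solvable)
qed

end
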